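(* Let $(X,d)$ be an ultrametric space. Then $(X,d)$ is metrically discrete if and only if $(\bar{\mathbf{B}}_X, d_H)$ is metrically discrete.
   Context: Metric spaces are nonempty. An ultrametric space is a metric space $(X,d)$ with $d(x,y)\le\max\{d(x,z),d(z,y)\}$ for all $x,y,z\in X$. For $c\in X$ and $r\ge 0$ the closed ball is $\bar B_r(c)=\{x\in X: d(c,x)\le r\}$ (so $\bar B_0(c)=\{c\}$). $\bar{\mathbf{B}}_X$ is the set of all closed balls $\bar B_r(c)$, $c\in X$, $r\ge 0$, regarded as subsets of $X$. The Hausdorff distance between nonempty closed bounded sets $A,B\subseteq X$ is $d_H(A,B)=\max\{\sup_{a\in A}\inf_{b\in B}d(a,b),\ \sup_{b\in B}\inf_{a\in A}d(a,b)\}$; $\bar{\mathbf{B}}_X$ is equipped with the metric $d_H$. A metric space $(Y,\delta)$ is metrically discrete if there exists $t>0$ such that $\delta(x,y)\ge t$ for all distinct $x,y\in Y$. *)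

theory Defs
  imports "HOL-Analysis.Analysis"
begin

locale Ultrametric_space = Metric_space +
  assumes nonempty: "M \<noteq> {}"
    and ultrametric: "\<And>x y z. \<lbrakk>x \<in> M; y \<in> M; z \<in> M\<rbrakk> \<Longrightarrow> d x y \<le> max (d x z) (d z y)"

(* Balls are subsets of M: different centre/radius pairs may give the same element. *)
definition (in Metric_space) closed_balls :: "'a set set" where
  "closed_balls = {mcball c r | c r. c \<in> M \<and> 0 \<le> r}"

(* The suprema and infima are those of the type real, hence meaningful only for nonempty
   sets A, B that are bounded with respect to d. *)
definition hausdorff_dist :: "('a \<Rightarrow> 'a \<Rightarrow> real) \<Rightarrow> 'a set \<Rightarrow> 'a set \<Rightarrow> real" where
  "hausdorff_dist d A B = max (SUP a\<in>A. INF b\<in>B. d a b) (SUP b\<in>B. INF a\<in>A. d a b)"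

(* The metric axioms are not part of this predicate: it is meant for Y, \<delta> forming a metric space. *)
definition metrically_discrete :: "'b set \<Rightarrow> ('b \<Rightarrow> 'b \<Rightarrow> real) \<Rightarrow> bool" where
  "metrically_discrete Y \<delta> \<longleftrightarrow> (\<exists>t>0. \<forall>x\<in>Y. \<forall>y\<in>Y. x \<noteq> y \<longrightarrow> \<delta> x y \<ge> t)"

end

(* If distinct points are at distance at least t and, say, a lies in the ball A but not in the
   ball B, then a is at distance at least t from every point of B, so the Hausdorff distance of
   A and B is at least t. Conversely, the singletons are the balls of radius 0 and form an
   isometric copy of the space. *)
theory Submission
  imports Defs
begin

context Metric_space
begin

lemma hausdorff_dist_commute: "hausdorff_dist d A B = hausdorff_dist d B A"
proof -
  \<comment> \<open>Flipping the arguments of \<open>d\<close> turns each one-sided supremum into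
    the one for the exchanged sets; only the order inside \<open>max\<close> is left to
    swap.\<close>
  have "hausdorff_dist d A B = hausdorff_dist (\<lambda>x y. d y x) A B"
    by (rule arg_cong[where f = "\<lambda>f. hausdorff_dist f A B"]) (intro ext commute)
  then show ?thesis
    by (simp add: hausdorff_dist_def max.commute)
qed

text \<open>The infimum at \<open>a\<close> is at least \<open>t\<close> and is one of the values
  under the first supremum. Boundedness of \<open>A\<close> ensures that this real supremum
  dominates its values.\<close>

lemma hausdorff_dist_ge:
  assumes "mbounded A" "B \<subseteq> M" "B \<noteq> {}" "a \<in> A"
    and t: "\<And>b. b \<in> B \<Longrightarrow> t \<le> d a b"
  shows "t \<le> hausdorff_dist d A B"
proof -
  obtain c r where cr: "c \<in> M" "\<And>x. x \<in> A \<Longrightarrow> x \<in> M \<and> d c x \<le> r"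
    using \<open>mbounded A\<close> \<open>a \<in> A\<close> unfolding mbounded by blast
  obtain b0 where b0: "b0 \<in> B" "b0 \<in> M"
    using assms by blast
  \<comment> \<open>Compare with the fixed point \<open>b0\<close>: going through the centre
    \<open>c\<close> of a ball around \<open>A\<close>, every point of \<open>A\<close> is within
    \<open>r + d c b0\<close> of it.\<close>
  have "bdd_above ((\<lambda>a. INF b\<in>B. d a b) ` A)"
  proof (rule bdd_aboveI2)
    fix x assume "x \<in> A"
    then have x: "x \<in> M" "d c x \<le> r"
      using cr by auto
    have "bdd_below (d x ` B)"
      by (rule bdd_belowI2 [of _ 0]) simp
    then have "(INF b\<in>B. d x b) \<le> d x b0"
      using b0 by (intro cINF_lower)
    also have "\<dots> \<le> d c x + d c b0"
      using triangle[of x c b0] commute[of x c] x cr b0 by simp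
    finally show "(INF b\<in>B. d x b) \<le> r + d c b0"
      using x by linarith
  qed
  then have "(INF b\<in>B. d a b) \<le> (SUP a\<in>A. INF b\<in>B. d a b)"
    using \<open>a \<in> A\<close> by (rule cSUP_upper2) simp
  moreover have "t \<le> (INF b\<in>B. d a b)"
    using assms by (intro cINF_greatest)
  ultimately show ?thesis
    by (simp add: hausdorff_dist_def)
qed

lemma hausdorff_dist_ge_of_neq:
  assumes t: "\<And>x y. \<lbrakk>x \<in> M; y \<in> M; x \<noteq> y\<rbrakk> \<Longrightarrow> t \<le> d x y"
    and AB: "mbounded A" "mbounded B" "A \<noteq> {}" "B \<noteq> {}" "A \<noteq> B"
  shows "t \<le> hausdorff_dist d A B"
proof -
  \<comment> \<open>Kept general in \<open>C\<close> and \<open>D\<close> so that it serves for a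
    point of \<open>A\<close> outside \<open>B\<close> and, by symmetry of the distance, for a point
    of \<open>B\<close> outside \<open>A\<close>.\<close>
  have one_sided: "t \<le> hausdorff_dist d C D"
    if C: "mbounded C" and D: "mbounded D" "D \<noteq> {}" and x: "x \<in> C" "x \<notin> D" for C D x
  proof (rule hausdorff_dist_ge)
    show "D \<subseteq> M"
      using D(1) by (rule mbounded_subset_mspace)
    show "t \<le> d x y" if "y \<in> D" for y
      using C x that \<open>D \<subseteq> M\<close> mbounded_subset_mspace t by blast
  qed (use C D x in auto)
  from AB consider x where "x \<in> A" "x \<notin> B" | x where "x \<in> B" "x \<notin> A"
    by blast
  then show ?thesis
  proof cases
    case 1
    with AB show ?thesis
      by (intro one_sided)
  next
    case 2
    with AB have "t \<le> hausdorff_dist d B A"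
      by (intro one_sided)
    then show ?thesis
      by (subst hausdorff_dist_commute)
  qed
qed

lemma closed_balls_singleton:
  assumes "x \<in> M"
  shows "{x} \<in> closed_balls"
proof -
  \<comment> \<open>Reading \<open>d x y \<le> 0\<close> as the negation of \<open>0 < d x y\<close>
    brings in the positivity of distances between distinct points.\<close>
  have "{x} = mcball x 0"
    using assms by (auto simp flip: not_less)
  then show ?thesis
    using assms unfolding closed_balls_def by blast
qed

lemma hausdorff_dist_singletons: "hausdorff_dist d {x} {y} = d x y"
  by (simp add: hausdorff_dist_def)

lemma metrically_discrete_iff_closed_balls:
  "metrically_discrete M d \<longleftrightarrow> metrically_discrete closed_balls (hausdorff_dist d)"
proof
  assume "metrically_discrete M d"
  then obtain t where t: "t > 0" "\<And>x y. \<lbrakk>x \<in> M; y \<in> M; x \<noteq> y\<rbrakk> \<Longrightarrow> t \<le> d x y"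
    by (auto simp: metrically_discrete_def)
  \<comment> \<open>Nonemptiness comes from \<open>0 \<le> r\<close>, which puts the centre into its
    ball.\<close>
  have "mbounded A \<and> A \<noteq> {}" if "A \<in> closed_balls" for A
  proof -
    obtain c r where "A = mcball c r" "c \<in> M" "0 \<le> r"
      using \<open>A \<in> closed_balls\<close> unfolding closed_balls_def by blast
    then have "mbounded A" "c \<in> A"
      by (simp_all add: mbounded_mcball)
    then show ?thesis
      by blast
  qed
  then show "metrically_discrete closed_balls (hausdorff_dist d)"
    unfolding metrically_discrete_def
    using t(1) hausdorff_dist_ge_of_neq[of t, OF t(2)] by (intro exI[of _ t]) simp
next
  assume "metrically_discrete closed_balls (hausdorff_dist d)"
  then obtain t where "t > 0"
    and t: "\<And>A B. \<lbrakk>A \<in> closed_balls; B \<in> closed_balls; A \<noteq> B\<rbrakk> \<Longrightarrow> t \<le> hausdorff_dist d A B"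
    unfolding metrically_discrete_def by blast
  \<comment> \<open>The separation constant of the balls carries over unchanged.\<close>
  have "t \<le> d x y" if "x \<in> M" "y \<in> M" "x \<noteq> y" for x y
    using t[of "{x}" "{y}"] that by (simp add: closed_balls_singleton hausdorff_dist_singletons)
  then show "metrically_discrete M d"
    unfolding metrically_discrete_def using \<open>t > 0\<close> by blast
qed

end

theorem theorem5p4:
  fixes X :: "'a set" and d :: "'a \<Rightarrow> 'a \<Rightarrow> real"
  assumes "Ultrametric_space X d"
  shows "metrically_discrete X d \<longleftrightarrow>
         metrically_discrete (Metric_space.closed_balls X d) (hausdorff_dist d)"
proof -
  interpret Ultrametric_space X d by fact
  show ?thesis by (rule metrically_discrete_iff_closed_balls)
qed

end
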